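(* Consider the quadrature-based discontinuous Galerkin method given in the context. Suppose the numerical flux $(T_i^{*m},v_i^{*m})$ is such that, for every mortar element $m$, at every point of $\hat m$ and for all values of the states $v_i^{\pm m},T_i^{\pm m}\in\mathbb R$ (only the minus states for boundary mortar elements), $$S_J^m\left((v_i^{-m}-v_i^{+m})T_i^{*m}+v_i^{*m}(T_i^{-m}-T_i^{+m})-v_i^{-m}T_i^{-m}+v_i^{+m}T_i^{+m}\right)\le 0$$ for interior mortar elements, and $$S_J^m\left(v_i^{-m}T_i^{*m}+v_i^{*m}T_i^{-m}-v_i^{-m}T_i^{-m}\right)\le 0$$ for boundary mortar elements. Then the discrete mortar energy rates $$\frac{d\mathcal E^m}{dt}=(\mathbf v_i^{-m}-\mathbf v_i^{+m})^T\mathbf W^m\mathbf T_i^{*m}+(\mathbf v_i^{*m})^T\mathbf W^m(\mathbf T_i^{-m}-\mathbf T_i^{+m})-(\mathbf v_i^{-m})^T\mathbf W^m\mathbf T_i^{-m}+(\mathbf v_i^{+m})^T\mathbf W^m\mathbf T_i^{+m}$$ (interior mortar elements) and $$\frac{d\mathcal E^m}{dt}=(\mathbf v_i^{-m})^T\mathbf W^m\mathbf T_i^{*m}+(\mathbf v_i^{*m})^T\mathbf W^m\mathbf T_i^{-m}-(\mathbf v_i^{-m})^T\mathbf W^m\mathbf T_i^{-m}$$ (boundary mortar elements) are non-positive, and every solution of the method satisfies the energy estimate $\mathcal E(t)\le\mathcal E(0)$ for $t\ge0$, i.e. the method is energy stable, where $$\mathcal E=\sum_{e\in\mathbb E}\mathcal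 E^e,\qquad \mathcal E^e=\frac12(\mathbf v_i^e)^T\mathbf M_\rho^e\mathbf v_i^e+\frac12(\boldsymbol\sigma_{ij}^e)^T\mathbf M^e_{S_{ijkl}}\boldsymbol\sigma_{kl}^e .$$
   Context: Conventions: $d\in\{2,3\}$; repeated subscripts $i,j,k,l$ are summed over $1,2,3$; for $d=2$ all objects representing $x_3$-derivatives and normal components $n_3$ are zero. Mesh: $\mathbb E$ is a finite set of volume elements and $\mathbb M$ a finite set of mortar elements partitioning the union of the element boundaries. $\mathbb M^e$ is the set of mortar elements meeting $\partial e$ and $\mathbb E^m=\{e:m\in\mathbb M^e\}$. Each $m$ has a chosen unit normal, and $\mathbb E^m=\mathbb E^{+m}\cup\mathbb E^{-m}$ (disjoint), where $\mathbb E^{+m}$ are the elements on the side toward which the normal points and $\mathbb E^{-m}$ those on the other side. Boundary mortar elements (on $\partial\Omega$) have $\mathbb E^{+m}=\emptyset$. Each element $e$ (mortar $m$) has a reference element $\hat e$ ($\hat m$). Discrete operators: functions in the finite-dimensional space $\hat V^e$ on $\hat e$ are represented by vectors of degrees of freedom (bold, superscript $e$). $\mathbf M_\rho^e$ is the $\rho$-weighted mass matrix, symmetric positive definite. For each $i,j,k,l$, $\mathbf M^e_{S_{ijkl}}$ is the (symmetric) mass matrix weighted by the compliance tensor component $S_{ijkl}$, so $\mathbf M^e_{S_{ijkl}}=\mathbf M^e_{S_{klij}}=\mathbf M^e_{S_{jikl}}=\mathbf M^e_{S_{ijlk}}$; it is assumed that $(\mathbf s_{ij})^T\mathbf M^e_{S_{ijkl}}\mathbf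 s_{kl}>0$ for every collection of vectors $\mathbf s_{ij}=\mathbf s_{ji}$ not all zero. These matrices are time independent. $\mathbf S_j^e$ is a square stiffness matrix, with $(\mathbf p^e)^T\mathbf S_j^e\mathbf q^e$ approximating $\int_{\hat e}J^ep^e\,\partial q^e/\partial x_j$; no summation-by-parts property is assumed. On $m$ there is a quadrature rule on $\hat m$ with $n_q^m$ nodes and positive weights $\omega_n^m$; $\mathbf W^m$ is the diagonal matrix with entries $\omega_n^mS_J^m$ evaluated at the $n$-th node, where $S_J^m>0$ is the surface Jacobian determinant. For $e\in\mathbb E^m$, $\mathbf P^{m,e}$ is a matrix taking degrees of freedom on $e$ to values at the mortar quadrature nodes (a projection/interpolation operator or an approximation of one). $\mathbf P^{m,e}_{n_j}$ is a matrix such that $\mathbf P^{m,e}_{n_j}\boldsymbol\sigma_{ij}^e$ (summed over $j$) is the approximate mortar traction at the quadrature nodes, obtained by multiplying by the unit normal (outward to $e$) before or after projection; one choice is fixed. Mortar states (vectors of values at the mortar quadrature nodes): $\mathbf v_i^{m,e}=\mathbf P^{m,e}\mathbf v_i^e$, $\mathbf T_i^{m,e}=\mathbf P^{m,e}_{n_j}\boldsymbol\sigma^e_{ij}$, $\mathbf v_i^{\pm m}=\sum_{e\in\mathbb E^{\pm m}}\mathbf v_i^{m,e}$, $\mathbf T_i^{\pm m}=\mp\sum_{e\in\mathbb E^{\pm m}}\mathbf T_i^{m,e}$; $\mathbf v_i^{m[e]}=\mathbf v_i^{\pm m}$ if $e\in\mathbb E^{\pm m}$. A numerical flux assigns at each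 point of $\hat m$ values $(T_i^{*m},v_i^{*m})$ as a function of the state values $v_i^{\pm m},T_i^{\pm m}$ at that point (only the minus states on boundary mortars); $\mathbf T_i^{*m},\mathbf v_i^{*m}$ are obtained by evaluating it at each mortar quadrature node. $\mathbf T_i^{*m[e]}=\mathbf T_i^{*m}$ if $e\in\mathbb E^{-m}$ and $-\mathbf T_i^{*m}$ if $e\in\mathbb E^{+m}$. Method: for each $e\in\mathbb E$ find (differentiable in $t$) $\mathbf v_i^e$ and symmetric $\boldsymbol\sigma_{ij}^e=\boldsymbol\sigma_{ji}^e$ such that $$\mathbf M_\rho^e\frac{d\mathbf v_i^e}{dt}=-(\mathbf S_j^e)^T\boldsymbol\sigma_{ij}^e+\sum_{m\in\mathbb M^e}(\mathbf P^{m,e})^T\mathbf W^m\mathbf T_i^{*m[e]},$$ and, for all symmetric collections of vectors $\boldsymbol\psi_{ij}=\boldsymbol\psi_{ji}$, $$(\boldsymbol\psi_{ij})^T\mathbf M^e_{S_{ijkl}}\frac{d\boldsymbol\sigma_{kl}^e}{dt}=(\boldsymbol\psi_{ij})^T\left[\frac12\left(\mathbf S_j^e\mathbf v_i^e+\mathbf S_i^e\mathbf v_j^e\right)+\sum_{m\in\mathbb M^e}(\mathbf P^{m,e}_{n_j})^T\mathbf W^m(\mathbf v_i^{*m}-\mathbf v_i^{m[e]})\right].$$ *)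

theory Defs
  imports
    Complex_Main
    "HOL-Library.Numeral_Type"
    "Jordan_Normal_Form.Matrix"
begin

text \<open>
  Cartesian indices range over the three-element type \<open>3\<close> in both space dimensions; its element
  \<open>3\<close> (which equals \<open>0\<close>) is the index of the \<open>x\<^sub>3\<close>-direction. Vectors of degrees of freedom and of
  mortar node values are vectors whose length depends on the element or mortar element.

  Elements, mortar elements and points of the reference mortar elements belong to arbitrary types:
  mesh geometry, basis functions and material enter only through the incidence sets, the surface
  Jacobian, the matrices and the flux, about which nothing beyond the assumptions of the locale
  below is supposed. \<open>proj_n\<close> contains the unit normal outward to the element.

  Arguments of the fluxes: mortar element, point of its reference element, then the states
  \<open>v\<^sup>-, v\<^sup>+, T\<^sup>-, T\<^sup>+\<close> (interior) or \<open>v\<^sup>-, T\<^sup>-\<close> (boundary). The result is the pair \<open>(T\<^sup>*, v\<^sup>*)\<close>.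
\<close>

record ('e, 'm, 'p) dg_data =
  space_dim :: nat
  elems :: "'e set"
  mortars :: "'m set"
  bdry_mortars :: "'m set"
  elem_mortars :: "'e \<Rightarrow> 'm set"
  plus_elems :: "'m \<Rightarrow> 'e set"
  minus_elems :: "'m \<Rightarrow> 'e set"
  ndof :: "'e \<Rightarrow> nat"
  mass_rho :: "'e \<Rightarrow> real mat"
  mass_S :: "'e \<Rightarrow> 3 \<Rightarrow> 3 \<Rightarrow> 3 \<Rightarrow> 3 \<Rightarrow> real mat"
  stiff :: "'e \<Rightarrow> 3 \<Rightarrow> real mat"
  ref_mortar :: "'m \<Rightarrow> 'p set"
  surf_jac :: "'m \<Rightarrow> 'p \<Rightarrow> real"
  nquad :: "'m \<Rightarrow> nat"
  quad_node :: "'m \<Rightarrow> nat \<Rightarrow> 'p"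
  quad_weight :: "'m \<Rightarrow> nat \<Rightarrow> real"
  proj :: "'m \<Rightarrow> 'e \<Rightarrow> real mat"
  proj_n :: "'m \<Rightarrow> 'e \<Rightarrow> 3 \<Rightarrow> real mat"
  flux_int :: "'m \<Rightarrow> 'p \<Rightarrow> (3 \<Rightarrow> real) \<Rightarrow> (3 \<Rightarrow> real) \<Rightarrow> (3 \<Rightarrow> real) \<Rightarrow> (3 \<Rightarrow> real)
    \<Rightarrow> (3 \<Rightarrow> real) \<times> (3 \<Rightarrow> real)"
  flux_bdry :: "'m \<Rightarrow> 'p \<Rightarrow> (3 \<Rightarrow> real) \<Rightarrow> (3 \<Rightarrow> real)
    \<Rightarrow> (3 \<Rightarrow> real) \<times> (3 \<Rightarrow> real)"

definition mortar_elems :: "('e, 'm, 'p) dg_data \<Rightarrow> 'm \<Rightarrow> 'e set" where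
  "mortar_elems D m = {e \<in> elems D. m \<in> elem_mortars D e}"

definition int_mortars :: "('e, 'm, 'p) dg_data \<Rightarrow> 'm set" where
  "int_mortars D = mortars D - bdry_mortars D"

text \<open>No summation-by-parts or consistency relation between the matrices is assumed.\<close>

locale dg_method =
  fixes D :: "('e, 'm, 'p) dg_data"
  assumes space_dim: "space_dim D \<in> {2, 3}"
    and finite_elems: "finite (elems D)"
    and finite_mortars: "finite (mortars D)"
    and elem_mortars: "e \<in> elems D \<Longrightarrow> elem_mortars D e \<subseteq> mortars D"
    and bdry_mortars: "bdry_mortars D \<subseteq> mortars D"
    and mortar_sides: "m \<in> mortars D \<Longrightarrow> mortar_elems D m = plus_elems D m \<union> minus_elems D m"
    and mortar_sides_disjoint: "m \<in> mortars D \<Longrightarrow> plus_elems D m \<inter> minus_elems D m = {}"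
    and bdry_plus: "m \<in> bdry_mortars D \<Longrightarrow> plus_elems D m = {}"
    and mass_rho_carrier: "e \<in> elems D \<Longrightarrow> mass_rho D e \<in> carrier_mat (ndof D e) (ndof D e)"
    and mass_rho_sym: "e \<in> elems D \<Longrightarrow> transpose_mat (mass_rho D e) = mass_rho D e"
    and mass_rho_pos: "\<lbrakk>e \<in> elems D; x \<in> carrier_vec (ndof D e); x \<noteq> 0\<^sub>v (ndof D e)\<rbrakk>
      \<Longrightarrow> x \<bullet> (mass_rho D e *\<^sub>v x) > 0"
    and mass_S_carrier: "e \<in> elems D \<Longrightarrow> mass_S D e i j k l \<in> carrier_mat (ndof D e) (ndof D e)"
    and mass_S_sym: "e \<in> elems D \<Longrightarrow> transpose_mat (mass_S D e i j k l) = mass_S D e i j k l"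
    and mass_S_major: "e \<in> elems D \<Longrightarrow> mass_S D e i j k l = mass_S D e k l i j"
    and mass_S_minor1: "e \<in> elems D \<Longrightarrow> mass_S D e i j k l = mass_S D e j i k l"
    and mass_S_minor2: "e \<in> elems D \<Longrightarrow> mass_S D e i j k l = mass_S D e i j l k"
    and mass_S_pos: "\<lbrakk>e \<in> elems D; \<And>i j. s i j \<in> carrier_vec (ndof D e); \<And>i j. s i j = s j i;
        \<exists>i j. s i j \<noteq> 0\<^sub>v (ndof D e)\<rbrakk>
      \<Longrightarrow> (\<Sum>i\<in>UNIV. \<Sum>j\<in>UNIV. \<Sum>k\<in>UNIV. \<Sum>l\<in>UNIV. s i j \<bullet> (mass_S D e i j k l *\<^sub>v s k l)) > 0"
    and stiff_carrier: "e \<in> elems D \<Longrightarrow> stiff D e j \<in> carrier_mat (ndof D e) (ndof D e)"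
    and stiff_2d: "\<lbrakk>space_dim D = 2; e \<in> elems D\<rbrakk> \<Longrightarrow> stiff D e 3 = 0\<^sub>m (ndof D e) (ndof D e)"
    and surf_jac_pos: "\<lbrakk>m \<in> mortars D; \<xi> \<in> ref_mortar D m\<rbrakk> \<Longrightarrow> surf_jac D m \<xi> > 0"
    and quad_node: "\<lbrakk>m \<in> mortars D; n < nquad D m\<rbrakk> \<Longrightarrow> quad_node D m n \<in> ref_mortar D m"
    and quad_weight_pos: "\<lbrakk>m \<in> mortars D; n < nquad D m\<rbrakk> \<Longrightarrow> quad_weight D m n > 0"
    and proj_carrier: "\<lbrakk>m \<in> mortars D; e \<in> mortar_elems D m\<rbrakk>
      \<Longrightarrow> proj D m e \<in> carrier_mat (nquad D m) (ndof D e)"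
    and proj_n_carrier: "\<lbrakk>m \<in> mortars D; e \<in> mortar_elems D m\<rbrakk>
      \<Longrightarrow> proj_n D m e j \<in> carrier_mat (nquad D m) (ndof D e)"
    and proj_n_2d: "\<lbrakk>space_dim D = 2; m \<in> mortars D; e \<in> mortar_elems D m\<rbrakk>
      \<Longrightarrow> proj_n D m e 3 = 0\<^sub>m (nquad D m) (ndof D e)"

abbreviation vsum :: "nat \<Rightarrow> ('a \<Rightarrow> real vec) \<Rightarrow> 'a set \<Rightarrow> real vec" where
  "vsum n \<equiv> finsum_vec TYPE(real) n"

definition mortar_weight :: "('e, 'm, 'p) dg_data \<Rightarrow> 'm \<Rightarrow> real mat" where
  "mortar_weight D m =
    mat_diag (nquad D m) (\<lambda>n. quad_weight D m n * surf_jac D m (quad_node D m n))"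

type_synonym 'e velocity = "'e \<Rightarrow> 3 \<Rightarrow> real vec"
type_synonym 'e stress = "'e \<Rightarrow> 3 \<Rightarrow> 3 \<Rightarrow> real vec"

definition dg_state :: "('e, 'm, 'p) dg_data \<Rightarrow> 'e velocity \<Rightarrow> 'e stress \<Rightarrow> bool" where
  "dg_state D v \<sigma> \<longleftrightarrow> (\<forall>e\<in>elems D. \<forall>i j.
     v e i \<in> carrier_vec (ndof D e) \<and> \<sigma> e i j \<in> carrier_vec (ndof D e) \<and> \<sigma> e i j = \<sigma> e j i)"

definition v_elem :: "('e, 'm, 'p) dg_data \<Rightarrow> 'e velocity \<Rightarrow> 'm \<Rightarrow> 'e \<Rightarrow> 3 \<Rightarrow> real vec" where
  "v_elem D v m e i = proj D m e *\<^sub>v v e i"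

definition T_elem :: "('e, 'm, 'p) dg_data \<Rightarrow> 'e stress \<Rightarrow> 'm \<Rightarrow> 'e \<Rightarrow> 3 \<Rightarrow> real vec" where
  "T_elem D \<sigma> m e i = vsum (nquad D m) (\<lambda>j. proj_n D m e j *\<^sub>v \<sigma> e i j) UNIV"

definition v_plus :: "('e, 'm, 'p) dg_data \<Rightarrow> 'e velocity \<Rightarrow> 'm \<Rightarrow> 3 \<Rightarrow> real vec" where
  "v_plus D v m i = vsum (nquad D m) (\<lambda>e. v_elem D v m e i) (plus_elems D m)"

definition v_minus :: "('e, 'm, 'p) dg_data \<Rightarrow> 'e velocity \<Rightarrow> 'm \<Rightarrow> 3 \<Rightarrow> real vec" where
  "v_minus D v m i = vsum (nquad D m) (\<lambda>e. v_elem D v m e i) (minus_elems D m)"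

text \<open>
  \<open>T_elem\<close> uses the normal outward to the element, whereas both traction states refer to the normal
  chosen on the mortar element; hence the sign in \<open>T_plus\<close>.
\<close>

definition T_plus :: "('e, 'm, 'p) dg_data \<Rightarrow> 'e stress \<Rightarrow> 'm \<Rightarrow> 3 \<Rightarrow> real vec" where
  "T_plus D \<sigma> m i = - vsum (nquad D m) (\<lambda>e. T_elem D \<sigma> m e i) (plus_elems D m)"

definition T_minus :: "('e, 'm, 'p) dg_data \<Rightarrow> 'e stress \<Rightarrow> 'm \<Rightarrow> 3 \<Rightarrow> real vec" where
  "T_minus D \<sigma> m i = vsum (nquad D m) (\<lambda>e. T_elem D \<sigma> m e i) (minus_elems D m)"

definition flux_at_node ::
  "('e, 'm, 'p) dg_data \<Rightarrow> 'e velocity \<Rightarrow> 'e stress \<Rightarrow> 'm \<Rightarrow> nat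
    \<Rightarrow> (3 \<Rightarrow> real) \<times> (3 \<Rightarrow> real)" where
  "flux_at_node D v \<sigma> m n =
    (if m \<in> bdry_mortars D
     then flux_bdry D m (quad_node D m n) (\<lambda>i. v_minus D v m i $ n) (\<lambda>i. T_minus D \<sigma> m i $ n)
     else flux_int D m (quad_node D m n) (\<lambda>i. v_minus D v m i $ n) (\<lambda>i. v_plus D v m i $ n)
            (\<lambda>i. T_minus D \<sigma> m i $ n) (\<lambda>i. T_plus D \<sigma> m i $ n))"

definition T_star ::
  "('e, 'm, 'p) dg_data \<Rightarrow> 'e velocity \<Rightarrow> 'e stress \<Rightarrow> 'm \<Rightarrow> 3 \<Rightarrow> real vec" where
  "T_star D v \<sigma> m i = vec (nquad D m) (\<lambda>n. fst (flux_at_node D v \<sigma> m n) i)"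

definition v_star ::
  "('e, 'm, 'p) dg_data \<Rightarrow> 'e velocity \<Rightarrow> 'e stress \<Rightarrow> 'm \<Rightarrow> 3 \<Rightarrow> real vec" where
  "v_star D v \<sigma> m i = vec (nquad D m) (\<lambda>n. snd (flux_at_node D v \<sigma> m n) i)"

definition v_side :: "('e, 'm, 'p) dg_data \<Rightarrow> 'e velocity \<Rightarrow> 'm \<Rightarrow> 'e \<Rightarrow> 3 \<Rightarrow> real vec" where
  "v_side D v m e i = (if e \<in> plus_elems D m then v_plus D v m i else v_minus D v m i)"

definition T_star_side ::
  "('e, 'm, 'p) dg_data \<Rightarrow> 'e velocity \<Rightarrow> 'e stress \<Rightarrow> 'm \<Rightarrow> 'e \<Rightarrow> 3 \<Rightarrow> real vec" where
  "T_star_side D v \<sigma> m e i =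
    (if e \<in> plus_elems D m then - T_star D v \<sigma> m i else T_star D v \<sigma> m i)"

definition velocity_rhs ::
  "('e, 'm, 'p) dg_data \<Rightarrow> 'e velocity \<Rightarrow> 'e stress \<Rightarrow> 'e \<Rightarrow> 3 \<Rightarrow> real vec" where
  "velocity_rhs D v \<sigma> e i =
    - vsum (ndof D e) (\<lambda>j. transpose_mat (stiff D e j) *\<^sub>v \<sigma> e i j) UNIV
    + vsum (ndof D e)
        (\<lambda>m. transpose_mat (proj D m e) *\<^sub>v (mortar_weight D m *\<^sub>v T_star_side D v \<sigma> m e i))
        (elem_mortars D e)"

definition stress_rhs ::
  "('e, 'm, 'p) dg_data \<Rightarrow> 'e velocity \<Rightarrow> 'e stress \<Rightarrow> 'e \<Rightarrow> 3 \<Rightarrow> 3 \<Rightarrow> real vec" where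
  "stress_rhs D v \<sigma> e i j =
    (1/2) \<cdot>\<^sub>v (stiff D e j *\<^sub>v v e i + stiff D e i *\<^sub>v v e j)
    + vsum (ndof D e)
        (\<lambda>m. transpose_mat (proj_n D m e j) *\<^sub>v
               (mortar_weight D m *\<^sub>v (v_star D v \<sigma> m i - v_side D v m e i)))
        (elem_mortars D e)"

definition has_vec_derivative :: "nat \<Rightarrow> (real \<Rightarrow> real vec) \<Rightarrow> real vec \<Rightarrow> real filter \<Rightarrow> bool" where
  "has_vec_derivative n f f' F \<longleftrightarrow>
     f' \<in> carrier_vec n \<and> (\<forall>a<n. ((\<lambda>t. f t $ a) has_real_derivative f' $ a) F)"

text \<open>Solutions live on \<open>t \<ge> 0\<close>; the derivative at \<open>t = 0\<close> is one-sided.\<close>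

definition dg_solution ::
  "('e, 'm, 'p) dg_data \<Rightarrow> (real \<Rightarrow> 'e velocity) \<Rightarrow> (real \<Rightarrow> 'e stress) \<Rightarrow> bool" where
  "dg_solution D v \<sigma> \<longleftrightarrow>
    (\<forall>t\<ge>0. dg_state D (v t) (\<sigma> t)) \<and>
    (\<exists>v' \<sigma>'. \<forall>t\<ge>0. \<forall>e\<in>elems D.
       (\<forall>i. has_vec_derivative (ndof D e) (\<lambda>s. v s e i) (v' t e i) (at t within {0..})) \<and>
       (\<forall>i j. has_vec_derivative (ndof D e) (\<lambda>s. \<sigma> s e i j) (\<sigma>' t e i j) (at t within {0..})) \<and>
       (\<forall>i. mass_rho D e *\<^sub>v v' t e i = velocity_rhs D (v t) (\<sigma> t) e i) \<and>
       (\<forall>\<psi>. (\<forall>i j. \<psi> i j \<in> carrier_vec (ndof D e) \<and> \<psi> i j = \<psi> j i) \<longrightarrow>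
          (\<Sum>i\<in>UNIV. \<Sum>j\<in>UNIV. \<Sum>k\<in>UNIV. \<Sum>l\<in>UNIV. \<psi> i j \<bullet> (mass_S D e i j k l *\<^sub>v \<sigma>' t e k l))
          = (\<Sum>i\<in>UNIV. \<Sum>j\<in>UNIV. \<psi> i j \<bullet> stress_rhs D (v t) (\<sigma> t) e i j)))"

definition elem_energy :: "('e, 'm, 'p) dg_data \<Rightarrow> 'e velocity \<Rightarrow> 'e stress \<Rightarrow> 'e \<Rightarrow> real" where
  "elem_energy D v \<sigma> e =
    1/2 * (\<Sum>i\<in>UNIV. v e i \<bullet> (mass_rho D e *\<^sub>v v e i))
    + 1/2 * (\<Sum>i\<in>UNIV. \<Sum>j\<in>UNIV. \<Sum>k\<in>UNIV. \<Sum>l\<in>UNIV.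
               \<sigma> e i j \<bullet> (mass_S D e i j k l *\<^sub>v \<sigma> e k l))"

definition energy :: "('e, 'm, 'p) dg_data \<Rightarrow> 'e velocity \<Rightarrow> 'e stress \<Rightarrow> real" where
  "energy D v \<sigma> = (\<Sum>e\<in>elems D. elem_energy D v \<sigma> e)"

definition int_energy_rate ::
  "('e, 'm, 'p) dg_data \<Rightarrow> 'e velocity \<Rightarrow> 'e stress \<Rightarrow> 'm \<Rightarrow> real" where
  "int_energy_rate D v \<sigma> m = (\<Sum>i\<in>UNIV.
      (v_minus D v m i - v_plus D v m i) \<bullet> (mortar_weight D m *\<^sub>v T_star D v \<sigma> m i)
    + v_star D v \<sigma> m i \<bullet> (mortar_weight D m *\<^sub>v (T_minus D \<sigma> m i - T_plus D \<sigma> m i))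
    - v_minus D v m i \<bullet> (mortar_weight D m *\<^sub>v T_minus D \<sigma> m i)
    + v_plus D v m i \<bullet> (mortar_weight D m *\<^sub>v T_plus D \<sigma> m i))"

definition bdry_energy_rate ::
  "('e, 'm, 'p) dg_data \<Rightarrow> 'e velocity \<Rightarrow> 'e stress \<Rightarrow> 'm \<Rightarrow> real" where
  "bdry_energy_rate D v \<sigma> m = (\<Sum>i\<in>UNIV.
      v_minus D v m i \<bullet> (mortar_weight D m *\<^sub>v T_star D v \<sigma> m i)
    + v_star D v \<sigma> m i \<bullet> (mortar_weight D m *\<^sub>v T_minus D \<sigma> m i)
    - v_minus D v m i \<bullet> (mortar_weight D m *\<^sub>v T_minus D \<sigma> m i))"

end

theory Submission
  imports Defs
begin

text \<open>
  Testing the two equations of the method with the solution itself, that is multiplying the first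
  by \<open>v\<^sub>i\<close> and taking \<open>\<psi> = \<sigma>\<close> in the second, turns the left-hand sides into the time derivative of
  the energy, because the mass matrices are symmetric and constant in time. On the right-hand sides
  the volume terms cancel: the velocity equation contains \<open>S\<^sub>j\<^sup>T\<close> and the stress equation \<open>S\<^sub>j\<close>, and
  contracting with the symmetric \<open>\<sigma>\<close> removes the symmetrisation of the discrete velocity gradient.
  Integration by parts is thus built into the pair of equations (\<open>volume_terms_cancel\<close>,
  \<open>element_power\<close>).

  What remains is a double sum over incident pairs of an element and a mortar element. Collected
  per mortar element, it depends on the elements only through the one-sided states, since the
  transposed projections in the equations are adjoint to those that define these states. The result
  is exactly the mortar energy rate (\<open>mortar_balance\<close>). As the mortar weight is diagonal, this rate
  is a sum over quadrature nodes of positive quadrature weights times the quantity that the flux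
  makes non-positive (\<open>int_energy_rate_nodes\<close>, \<open>bdry_energy_rate_nodes\<close>). So the energy has a
  non-positive derivative and is nonincreasing.
\<close>

section \<open>Scalar products and sums of vectors\<close>

lemma vsum_closed:
  "(\<And>a. a \<in> A \<Longrightarrow> f a \<in> carrier_vec n) \<Longrightarrow> vsum n f A \<in> carrier_vec n"
  by (rule finsum_vec_closed) auto

lemma vsum_scalar_prod:
  assumes "finite A" "\<And>a. a \<in> A \<Longrightarrow> f a \<in> carrier_vec n" "y \<in> carrier_vec n"
  shows "vsum n f A \<bullet> y = (\<Sum>a\<in>A. f a \<bullet> y)"
proof -
  have "vsum n f A \<bullet> y = (\<Sum>k\<in>{0..<n}. (\<Sum>a\<in>A. f a $ k) * y $ k)"
    using assms by (auto simp: scalar_prod_def index_finsum_vec intro!: sum.cong)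
  also have "\<dots> = (\<Sum>a\<in>A. \<Sum>k\<in>{0..<n}. f a $ k * y $ k)"
    by (simp add: sum_distrib_right sum.swap[of _ A])
  also have "\<dots> = (\<Sum>a\<in>A. f a \<bullet> y)"
    using assms by (simp add: scalar_prod_def)
  finally show ?thesis .
qed

lemma scalar_prod_vsum:
  assumes "finite A" "\<And>a. a \<in> A \<Longrightarrow> f a \<in> carrier_vec n" "y \<in> carrier_vec n"
  shows "y \<bullet> vsum n f A = (\<Sum>a\<in>A. y \<bullet> f a)"
proof -
  have "y \<bullet> vsum n f A = vsum n f A \<bullet> y"
    using assms by (intro comm_scalar_prod[of _ n] vsum_closed) auto
  also have "\<dots> = (\<Sum>a\<in>A. f a \<bullet> y)"
    using assms by (rule vsum_scalar_prod)
  also have "\<dots> = (\<Sum>a\<in>A. y \<bullet> f a)"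
    using assms by (intro sum.cong refl comm_scalar_prod[of _ n]) auto
  finally show ?thesis .
qed

lemma scalar_prod_transpose_mult:
  fixes A :: "real mat"
  assumes "A \<in> carrier_mat nr nc" "x \<in> carrier_vec nc" "y \<in> carrier_vec nr"
  shows "x \<bullet> (transpose_mat A *\<^sub>v y) = (A *\<^sub>v x) \<bullet> y"
proof -
  have "x \<bullet> (transpose_mat A *\<^sub>v y) = (transpose_mat A *\<^sub>v y) \<bullet> x"
    using assms by (intro comm_scalar_prod[of _ nc] mult_mat_vec_carrier[of _ _ nr]) auto
  also have "\<dots> = y \<bullet> (A *\<^sub>v x)"
    using assms by (rule transpose_vec_mult_scalar)
  also have "\<dots> = (A *\<^sub>v x) \<bullet> y"
    using assms by (intro comm_scalar_prod[of _ nr]) auto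
  finally show ?thesis .
qed

lemma mortar_weight_carrier [simp]:
  "mortar_weight D m \<in> carrier_mat (nquad D m) (nquad D m)"
  by (simp add: mortar_weight_def)

lemma mortar_weight_scalar_prod:
  assumes "y \<in> carrier_vec (nquad D m)"
  shows "x \<bullet> (mortar_weight D m *\<^sub>v y) =
    (\<Sum>n<nquad D m. quad_weight D m n * surf_jac D m (quad_node D m n) * (x $ n * y $ n))"
proof -
  define w where "w n = quad_weight D m n * surf_jac D m (quad_node D m n)" for n
  have "(mortar_weight D m *\<^sub>v y) $ n = w n * y $ n" if n: "n < nquad D m" for n
  proof -
    have "(mortar_weight D m *\<^sub>v y) $ n
        = (\<Sum>k\<in>{0..<nquad D m}. (if n = k then w k else 0) * y $ k)"
      using n assms by (auto simp: mortar_weight_def mat_diag_def scalar_prod_def w_def intro!: sum.cong)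
    also have "\<dots> = (\<Sum>k\<in>{0..<nquad D m}. if n = k then w k * y $ k else 0)"
      by (intro sum.cong) auto
    also have "\<dots> = w n * y $ n"
      using n by simp
    finally show ?thesis .
  qed
  moreover have "dim_vec (mortar_weight D m *\<^sub>v y) = nquad D m"
    using carrier_matD(1)[OF mortar_weight_carrier[of D m]] by simp
  ultimately show ?thesis
    by (auto simp: scalar_prod_def w_def lessThan_atLeast0 algebra_simps intro!: sum.cong)
qed

section \<open>Differentiating bilinear forms\<close>

lemma scalar_prod_mult_mat_vec_sum:
  fixes M :: "real mat"
  assumes "M \<in> carrier_mat n n" "y \<in> carrier_vec n"
  shows "x \<bullet> (M *\<^sub>v y) = (\<Sum>a<n. \<Sum>b<n. x $ a * (M $$ (a, b) * y $ b))"
  using assms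
  by (auto simp: scalar_prod_def lessThan_atLeast0 sum_distrib_left intro!: sum.cong)

text \<open>
  Membership in the vector space is required on the set \<open>S\<close> only, as a solution is a vector of the
  right length only for nonnegative times.
\<close>

lemma bilinear_form_has_derivative:
  fixes M :: "real mat"
  assumes M: "M \<in> carrier_mat n n"
    and f: "has_vec_derivative n f f' (at t within S)"
    and g: "has_vec_derivative n g g' (at t within S)"
    and carrier: "\<And>s. s \<in> S \<Longrightarrow> g s \<in> carrier_vec n"
    and t: "t \<in> S"
  shows "((\<lambda>s. f s \<bullet> (M *\<^sub>v g s)) has_real_derivative (f' \<bullet> (M *\<^sub>v g t) + f t \<bullet> (M *\<^sub>v g')))
    (at t within S)"
proof -
  have g': "g' \<in> carrier_vec n"
    using g by (simp add: has_vec_derivative_def)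
  have "((\<lambda>s. \<Sum>a<n. \<Sum>b<n. f s $ a * (M $$ (a, b) * g s $ b)) has_real_derivative
      (\<Sum>a<n. \<Sum>b<n. f' $ a * (M $$ (a, b) * g t $ b) + f t $ a * (M $$ (a, b) * g' $ b)))
      (at t within S)"
    using f g unfolding has_vec_derivative_def
    by (intro DERIV_sum) (auto intro!: derivative_eq_intros simp: algebra_simps)
  then have "((\<lambda>s. \<Sum>a<n. \<Sum>b<n. f s $ a * (M $$ (a, b) * g s $ b)) has_real_derivative
      (f' \<bullet> (M *\<^sub>v g t) + f t \<bullet> (M *\<^sub>v g'))) (at t within S)"
    by (simp add: scalar_prod_mult_mat_vec_sum[OF M] g' carrier t sum.distrib)
  then show ?thesis
    by (rule has_field_derivative_transform_within[of _ _ _ _ 1])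
       (use t in \<open>auto simp: scalar_prod_mult_mat_vec_sum[OF M] carrier\<close>)
qed

lemma symmetric_form_commute:
  fixes M :: "real mat"
  assumes "M \<in> carrier_mat n n" "transpose_mat M = M" "x \<in> carrier_vec n" "y \<in> carrier_vec n"
  shows "x \<bullet> (M *\<^sub>v y) = y \<bullet> (M *\<^sub>v x)"
  using assms scalar_prod_transpose_mult[of M n n x y] comm_scalar_prod[of "M *\<^sub>v x" n y]
  by simp

lemma sum_swap_pairs:
  "(\<Sum>i\<in>A. \<Sum>j\<in>B. \<Sum>k\<in>C. \<Sum>l\<in>E. F i j k l) = (\<Sum>k\<in>C. \<Sum>l\<in>E. \<Sum>i\<in>A. \<Sum>j\<in>B. F i j k l)"
proof -
  have "(\<Sum>i\<in>A. \<Sum>j\<in>B. \<Sum>k\<in>C. \<Sum>l\<in>E. F i j k l) = (\<Sum>i\<in>A. \<Sum>k\<in>C. \<Sum>l\<in>E. \<Sum>j\<in>B. F i j k l)"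
    by (simp add: sum.swap[of _ _ B])
  also have "\<dots> = (\<Sum>k\<in>C. \<Sum>l\<in>E. \<Sum>i\<in>A. \<Sum>j\<in>B. F i j k l)"
    by (simp add: sum.swap[of _ _ A])
  finally show ?thesis .
qed

section \<open>Mortar states and mortar energy rates\<close>

text \<open>
  The power that the element \<open>e\<close> receives through the mortar element \<open>m\<close>: the mortar terms of both
  equations, tested with the solution.
\<close>

definition side_power ::
  "('e, 'm, 'p) dg_data \<Rightarrow> 'e velocity \<Rightarrow> 'e stress \<Rightarrow> 'm \<Rightarrow> 'e \<Rightarrow> real" where
  "side_power D v \<sigma> m e = (\<Sum>i\<in>UNIV.
      v_elem D v m e i \<bullet> (mortar_weight D m *\<^sub>v T_star_side D v \<sigma> m e i)
    + T_elem D \<sigma> m e i \<bullet> (mortar_weight D m *\<^sub>v (v_star D v \<sigma> m i - v_side D v m e i)))"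

lemma T_star_carrier [simp]: "T_star D v \<sigma> m i \<in> carrier_vec (nquad D m)"
  by (simp add: T_star_def)

lemma v_star_carrier [simp]: "v_star D v \<sigma> m i \<in> carrier_vec (nquad D m)"
  by (simp add: v_star_def)

context dg_method
begin

lemma finite_mortar_elems: "finite (mortar_elems D m)"
  using finite_elems by (simp add: mortar_elems_def)

lemma finite_sides:
  assumes "m \<in> mortars D"
  shows "finite (plus_elems D m)" "finite (minus_elems D m)"
  using mortar_sides[OF assms] finite_mortar_elems[of m] by auto

lemma v_elem_carrier:
  assumes "dg_state D v \<sigma>" "m \<in> mortars D" "e \<in> mortar_elems D m"
  shows "v_elem D v m e i \<in> carrier_vec (nquad D m)"
  using assms proj_carrier[OF assms(2,3)]
  by (auto simp: v_elem_def dg_state_def mortar_elems_def intro!: mult_mat_vec_carrier)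

lemma T_elem_carrier:
  assumes "dg_state D v \<sigma>" "m \<in> mortars D" "e \<in> mortar_elems D m"
  shows "T_elem D \<sigma> m e i \<in> carrier_vec (nquad D m)"
  using assms proj_n_carrier[OF assms(2,3)]
  by (auto simp: T_elem_def dg_state_def mortar_elems_def
      intro!: vsum_closed mult_mat_vec_carrier)

lemma mortar_state_carriers:
  assumes "dg_state D v \<sigma>" "m \<in> mortars D"
  shows "v_plus D v m i \<in> carrier_vec (nquad D m)"
    and "v_minus D v m i \<in> carrier_vec (nquad D m)"
    and "T_plus D \<sigma> m i \<in> carrier_vec (nquad D m)"
    and "T_minus D \<sigma> m i \<in> carrier_vec (nquad D m)"
  using mortar_sides[OF assms(2)] v_elem_carrier[OF assms] T_elem_carrier[OF assms]
  by (auto simp: v_plus_def v_minus_def T_plus_def T_minus_def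
      intro!: vsum_closed uminus_carrier_vec[THEN iffD2])

lemma v_side_carrier:
  assumes "dg_state D v \<sigma>" "m \<in> mortars D"
  shows "v_side D v m e i \<in> carrier_vec (nquad D m)"
  using mortar_state_carriers[OF assms] by (simp add: v_side_def)

lemma T_star_side_carrier: "T_star_side D v \<sigma> m e i \<in> carrier_vec (nquad D m)"
  by (simp add: T_star_side_def)

text \<open>
  The states \<open>v\<^sup>*\<close>, \<open>T\<^sup>*\<close>, \<open>v\<^sup>\<plusminus>\<close> are the same for all elements on one side of a mortar element. The
  power of the elements on that side is therefore linear in their projections, and these sum up to
  the one-sided states.
\<close>

lemma side_powers_add_up:
  assumes state: "dg_state D v \<sigma>" and m: "m \<in> mortars D"
    and A: "finite A" "A \<subseteq> mortar_elems D m"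
    and T: "\<And>i. T i \<in> carrier_vec (nquad D m)" and u: "\<And>i. u i \<in> carrier_vec (nquad D m)"
  shows "(\<Sum>e\<in>A. \<Sum>i\<in>UNIV. v_elem D v m e i \<bullet> (mortar_weight D m *\<^sub>v T i)
        + T_elem D \<sigma> m e i \<bullet> (mortar_weight D m *\<^sub>v u i))
    = (\<Sum>i\<in>UNIV. vsum (nquad D m) (\<lambda>e. v_elem D v m e i) A \<bullet> (mortar_weight D m *\<^sub>v T i)
        + vsum (nquad D m) (\<lambda>e. T_elem D \<sigma> m e i) A \<bullet> (mortar_weight D m *\<^sub>v u i))"
proof -
  have "vsum (nquad D m) (\<lambda>e. v_elem D v m e i) A \<bullet> (mortar_weight D m *\<^sub>v T i)
      = (\<Sum>e\<in>A. v_elem D v m e i \<bullet> (mortar_weight D m *\<^sub>v T i))" for i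
    using A v_elem_carrier[OF state m] T
    by (intro vsum_scalar_prod mult_mat_vec_carrier[OF mortar_weight_carrier]) auto
  moreover have "vsum (nquad D m) (\<lambda>e. T_elem D \<sigma> m e i) A \<bullet> (mortar_weight D m *\<^sub>v u i)
      = (\<Sum>e\<in>A. T_elem D \<sigma> m e i \<bullet> (mortar_weight D m *\<^sub>v u i))" for i
    using A T_elem_carrier[OF state m] u
    by (intro vsum_scalar_prod mult_mat_vec_carrier[OF mortar_weight_carrier]) auto
  ultimately show ?thesis
    by (subst sum.swap) (simp add: sum.distrib)
qed

text \<open>
  Elements on the plus side receive \<open>-T\<^sup>*\<close>, and the outward tractions there sum to \<open>-T\<^sup>+\<close>. These two
  signs produce the jumps \<open>v\<^sup>- - v\<^sup>+\<close> and \<open>T\<^sup>- - T\<^sup>+\<close> of the rate. The formula for interior mortar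
  elements serves for all of them, because the plus states on the boundary are empty sums.
\<close>

lemma mortar_balance:
  assumes state: "dg_state D v \<sigma>" and m: "m \<in> mortars D"
  shows "(\<Sum>e\<in>mortar_elems D m. side_power D v \<sigma> m e) = int_energy_rate D v \<sigma> m"
proof -
  let ?W = "mortar_weight D m"
  note sides = mortar_sides[OF m] finite_sides[OF m]
  note car = mortar_state_carriers[OF state m]
  note dims = car[THEN carrier_vecD] T_star_carrier[THEN carrier_vecD]
  have plus_sum: "vsum (nquad D m) (\<lambda>e. T_elem D \<sigma> m e i) (plus_elems D m) = - T_plus D \<sigma> m i" for i
    by (simp add: T_plus_def)
  have minus: "(\<Sum>e\<in>minus_elems D m. side_power D v \<sigma> m e) = (\<Sum>i\<in>UNIV.
      v_minus D v m i \<bullet> (?W *\<^sub>v T_star D v \<sigma> m i)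
      + T_minus D \<sigma> m i \<bullet> (?W *\<^sub>v (v_star D v \<sigma> m i - v_minus D v m i)))"
  proof -
    have "side_power D v \<sigma> m e = (\<Sum>i\<in>UNIV.
        v_elem D v m e i \<bullet> (?W *\<^sub>v T_star D v \<sigma> m i)
        + T_elem D \<sigma> m e i \<bullet> (?W *\<^sub>v (v_star D v \<sigma> m i - v_minus D v m i)))"
      if "e \<in> minus_elems D m" for e
    proof -
      have "e \<notin> plus_elems D m"
        using that mortar_sides_disjoint[OF m] by auto
      then show ?thesis
        by (simp add: side_power_def T_star_side_def v_side_def)
    qed
    then show ?thesis
      unfolding v_minus_def T_minus_def
      using sides car
      by (subst side_powers_add_up[OF state m, symmetric]) (auto simp: v_minus_def)
  qed
  have plus: "(\<Sum>e\<in>plus_elems D m. side_power D v \<sigma> m e) = (\<Sum>i\<in>UNIV.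
      v_plus D v m i \<bullet> (?W *\<^sub>v (- T_star D v \<sigma> m i))
      + (- T_plus D \<sigma> m i) \<bullet> (?W *\<^sub>v (v_star D v \<sigma> m i - v_plus D v m i)))"
  proof -
    have "side_power D v \<sigma> m e = (\<Sum>i\<in>UNIV.
        v_elem D v m e i \<bullet> (?W *\<^sub>v (- T_star D v \<sigma> m i))
        + T_elem D \<sigma> m e i \<bullet> (?W *\<^sub>v (v_star D v \<sigma> m i - v_plus D v m i)))"
      if "e \<in> plus_elems D m" for e
      using that by (simp add: side_power_def T_star_side_def v_side_def)
    then show ?thesis
      unfolding plus_sum[symmetric]
      using sides car
      by (subst v_plus_def, subst side_powers_add_up[OF state m, symmetric]) auto
  qed
  have "(\<Sum>e\<in>mortar_elems D m. side_power D v \<sigma> m e)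
      = (\<Sum>e\<in>plus_elems D m. side_power D v \<sigma> m e) + (\<Sum>e\<in>minus_elems D m. side_power D v \<sigma> m e)"
    unfolding sides(1) using sides mortar_sides_disjoint[OF m] by (intro sum.union_disjoint)
  also have "\<dots> = int_energy_rate D v \<sigma> m"
    unfolding plus minus int_energy_rate_def sum.distrib[symmetric]
    using car
    by (intro sum.cong refl)
      (auto simp: mortar_weight_scalar_prod dims sum.distrib[symmetric] sum_subtractf[symmetric]
        algebra_simps intro!: sum.cong)
  finally show ?thesis .
qed

lemma bdry_rate_eq_int_rate:
  assumes state: "dg_state D v \<sigma>" and m: "m \<in> bdry_mortars D"
  shows "bdry_energy_rate D v \<sigma> m = int_energy_rate D v \<sigma> m"
proof -
  have "m \<in> mortars D"
    using m bdry_mortars by auto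
  note car = mortar_state_carriers[OF state this]
  note dims = car[THEN carrier_vecD]
  have "v_plus D v m i = 0\<^sub>v (nquad D m)" "T_plus D \<sigma> m i = 0\<^sub>v (nquad D m)" for i
    using bdry_plus[OF m] by (simp_all add: v_plus_def T_plus_def finsum_vec_empty)
  then show ?thesis
    unfolding bdry_energy_rate_def int_energy_rate_def
    using car
    by (intro sum.cong refl)
      (auto simp: mortar_weight_scalar_prod dims sum.distrib[symmetric] sum_subtractf[symmetric]
        algebra_simps intro!: sum.cong)
qed

text \<open>
  As the mortar weight is diagonal, a mortar energy rate is the quadrature of the pointwise
  expression whose sign the flux controls.
\<close>

lemma int_energy_rate_nodes:
  assumes state: "dg_state D v \<sigma>" and m: "m \<in> mortars D"
  shows "int_energy_rate D v \<sigma> m = (\<Sum>n<nquad D m. quad_weight D m n *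
    (surf_jac D m (quad_node D m n) * (\<Sum>i\<in>UNIV.
        (v_minus D v m i $ n - v_plus D v m i $ n) * T_star D v \<sigma> m i $ n
      + v_star D v \<sigma> m i $ n * (T_minus D \<sigma> m i $ n - T_plus D \<sigma> m i $ n)
      - v_minus D v m i $ n * T_minus D \<sigma> m i $ n + v_plus D v m i $ n * T_plus D \<sigma> m i $ n)))"
  unfolding int_energy_rate_def sum_distrib_left
  using mortar_state_carriers[OF state m]
  by (subst sum.swap[of _ UNIV "{..<nquad D m}"], intro sum.cong refl)
    (auto simp: mortar_weight_scalar_prod mortar_state_carriers[OF state m, THEN carrier_vecD]
      sum.distrib[symmetric] sum_subtractf[symmetric]
      algebra_simps intro!: sum.cong)

lemma bdry_energy_rate_nodes:
  assumes state: "dg_state D v \<sigma>" and m: "m \<in> mortars D"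
  shows "bdry_energy_rate D v \<sigma> m = (\<Sum>n<nquad D m. quad_weight D m n *
    (surf_jac D m (quad_node D m n) * (\<Sum>i\<in>UNIV.
        v_minus D v m i $ n * T_star D v \<sigma> m i $ n
      + v_star D v \<sigma> m i $ n * T_minus D \<sigma> m i $ n
      - v_minus D v m i $ n * T_minus D \<sigma> m i $ n)))"
  unfolding bdry_energy_rate_def sum_distrib_left
  using mortar_state_carriers[OF state m]
  by (subst sum.swap[of _ UNIV "{..<nquad D m}"], intro sum.cong refl)
    (auto simp: mortar_weight_scalar_prod mortar_state_carriers[OF state m, THEN carrier_vecD]
      sum.distrib[symmetric] sum_subtractf[symmetric]
      algebra_simps intro!: sum.cong)

section \<open>Energy balance\<close>

text \<open>
  The factor \<open>1/2\<close> and the second, index-swapped half of the symmetrised gradient combine to a single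
  copy because \<open>\<sigma>\<close> is symmetric.
\<close>

lemma volume_terms_cancel:
  assumes state: "dg_state D v \<sigma>" and e: "e \<in> elems D"
  shows "(\<Sum>i\<in>UNIV. \<Sum>j\<in>UNIV. \<sigma> e i j \<bullet> ((1/2) \<cdot>\<^sub>v (stiff D e j *\<^sub>v v e i + stiff D e i *\<^sub>v v e j)))
    = (\<Sum>i\<in>UNIV. v e i \<bullet> vsum (ndof D e) (\<lambda>j. transpose_mat (stiff D e j) *\<^sub>v \<sigma> e i j) UNIV)"
proof -
  let ?a = "\<lambda>i j. \<sigma> e i j \<bullet> (stiff D e j *\<^sub>v v e i)"
  have v: "v e i \<in> carrier_vec (ndof D e)" and s: "\<sigma> e i j \<in> carrier_vec (ndof D e)"
    and sym: "\<sigma> e i j = \<sigma> e j i" for i j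
    using state e by (auto simp: dg_state_def)
  have Sv: "stiff D e j *\<^sub>v v e i \<in> carrier_vec (ndof D e)" for i j
    by (rule mult_mat_vec_carrier[OF stiff_carrier[OF e] v])
  have Ss: "transpose_mat (stiff D e j) *\<^sub>v \<sigma> e i j \<in> carrier_vec (ndof D e)" for i j
    using stiff_carrier[OF e] s by (intro mult_mat_vec_carrier[of _ _ "ndof D e"]) auto
  have "\<sigma> e i j \<bullet> ((1/2) \<cdot>\<^sub>v (stiff D e j *\<^sub>v v e i + stiff D e i *\<^sub>v v e j))
      = 1/2 * ?a i j + 1/2 * ?a j i" for i j
  proof -
    have "\<sigma> e i j \<bullet> ((1/2) \<cdot>\<^sub>v (stiff D e j *\<^sub>v v e i + stiff D e i *\<^sub>v v e j))
        = 1/2 * (\<sigma> e i j \<bullet> (stiff D e j *\<^sub>v v e i + stiff D e i *\<^sub>v v e j))"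
      using Sv s by (intro scalar_prod_smult_distrib add_carrier_vec)
    also have "\<dots> = 1/2 * (?a i j + \<sigma> e i j \<bullet> (stiff D e i *\<^sub>v v e j))"
      using scalar_prod_add_distrib[OF s Sv Sv] by simp
    finally show ?thesis
      using sym[of i j] by (simp add: algebra_simps)
  qed
  then have "(\<Sum>i\<in>UNIV. \<Sum>j\<in>UNIV.
        \<sigma> e i j \<bullet> ((1/2) \<cdot>\<^sub>v (stiff D e j *\<^sub>v v e i + stiff D e i *\<^sub>v v e j)))
      = 1/2 * (\<Sum>i\<in>UNIV. \<Sum>j\<in>UNIV. ?a i j) + 1/2 * (\<Sum>i\<in>UNIV. \<Sum>j\<in>UNIV. ?a j i)"
    by (simp add: sum.distrib sum_distrib_left)
  also have "(\<Sum>i\<in>UNIV. \<Sum>j\<in>UNIV. ?a j i) = (\<Sum>i\<in>UNIV. \<Sum>j\<in>UNIV. ?a i j)"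
    by (rule sum.swap)
  also have "1/2 * (\<Sum>i\<in>UNIV. \<Sum>j\<in>UNIV. ?a i j) + 1/2 * (\<Sum>i\<in>UNIV. \<Sum>j\<in>UNIV. ?a i j)
      = (\<Sum>i\<in>UNIV. \<Sum>j\<in>UNIV. ?a i j)"
    by simp
  also have "\<dots> = (\<Sum>i\<in>UNIV. \<Sum>j\<in>UNIV. v e i \<bullet> (transpose_mat (stiff D e j) *\<^sub>v \<sigma> e i j))"
    using scalar_prod_transpose_mult[OF stiff_carrier[OF e] v s] comm_scalar_prod[OF s Sv] by simp
  also have "\<dots> = (\<Sum>i\<in>UNIV. v e i \<bullet> vsum (ndof D e) (\<lambda>j. transpose_mat (stiff D e j) *\<^sub>v \<sigma> e i j) UNIV)"
    by (intro sum.cong refl scalar_prod_vsum[symmetric] Ss v) simp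
  finally show ?thesis .
qed

lemma element_power:
  assumes state: "dg_state D v \<sigma>" and e: "e \<in> elems D"
  shows "(\<Sum>i\<in>UNIV. v e i \<bullet> velocity_rhs D v \<sigma> e i)
      + (\<Sum>i\<in>UNIV. \<Sum>j\<in>UNIV. \<sigma> e i j \<bullet> stress_rhs D v \<sigma> e i j)
    = (\<Sum>m\<in>elem_mortars D e. side_power D v \<sigma> m e)"
proof -
  let ?N = "ndof D e" and ?ms = "elem_mortars D e"
  have fin: "finite ?ms"
    using elem_mortars[OF e] finite_mortars by (rule finite_subset)
  have v: "v e i \<in> carrier_vec ?N" and s: "\<sigma> e i j \<in> carrier_vec ?N" for i j
    using state e by (auto simp: dg_state_def)
  have m: "m \<in> mortars D" "e \<in> mortar_elems D m" if "m \<in> ?ms" for m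
    using that e elem_mortars[OF e] by (auto simp: mortar_elems_def)
  let ?t = "\<lambda>m i. mortar_weight D m *\<^sub>v T_star_side D v \<sigma> m e i"
  let ?u = "\<lambda>m i. mortar_weight D m *\<^sub>v (v_star D v \<sigma> m i - v_side D v m e i)"
  have t: "?t m i \<in> carrier_vec (nquad D m)" for m i
    by (intro mult_mat_vec_carrier[OF mortar_weight_carrier] T_star_side_carrier)
  have u: "?u m i \<in> carrier_vec (nquad D m)" if "m \<in> ?ms" for m i
    using v_side_carrier[OF state m(1)[OF that]]
    by (intro mult_mat_vec_carrier[OF mortar_weight_carrier] minus_carrier_vec) auto
  have Pt: "transpose_mat (proj D m e) *\<^sub>v ?t m i \<in> carrier_vec ?N" if "m \<in> ?ms" for m i
    using proj_carrier[OF m[OF that]] by (intro mult_mat_vec_carrier[OF _ t]) auto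
  have Pu: "transpose_mat (proj_n D m e j) *\<^sub>v ?u m i \<in> carrier_vec ?N" if "m \<in> ?ms" for m i j
    using proj_n_carrier[OF m[OF that]] by (intro mult_mat_vec_carrier[OF _ u[OF that]]) auto
  let ?S = "\<lambda>i. vsum ?N (\<lambda>j. transpose_mat (stiff D e j) *\<^sub>v \<sigma> e i j) UNIV"
  let ?G = "\<lambda>i j. (1/2) \<cdot>\<^sub>v (stiff D e j *\<^sub>v v e i + stiff D e i *\<^sub>v v e j)"
  have S: "?S i \<in> carrier_vec ?N" for i
    using stiff_carrier[OF e] s by (intro vsum_closed mult_mat_vec_carrier[of _ _ ?N]) auto
  have G: "?G i j \<in> carrier_vec ?N" for i j
    by (intro smult_carrier_vec[THEN iffD2] add_carrier_vec
        mult_mat_vec_carrier[OF stiff_carrier[OF e] v])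
  have velocity: "v e i \<bullet> velocity_rhs D v \<sigma> e i
      = - (v e i \<bullet> ?S i) + (\<Sum>m\<in>?ms. v_elem D v m e i \<bullet> ?t m i)" for i
  proof -
    have "v e i \<bullet> velocity_rhs D v \<sigma> e i
        = v e i \<bullet> (- ?S i) + v e i \<bullet> vsum ?N (\<lambda>m. transpose_mat (proj D m e) *\<^sub>v ?t m i) ?ms"
      unfolding velocity_rhs_def using S v Pt
      by (intro scalar_prod_add_distrib[of _ ?N] vsum_closed) auto
    also have "v e i \<bullet> (- ?S i) = - (v e i \<bullet> ?S i)"
      using S[of i] v[of i] by simp
    also have "v e i \<bullet> vsum ?N (\<lambda>m. transpose_mat (proj D m e) *\<^sub>v ?t m i) ?ms
        = (\<Sum>m\<in>?ms. v e i \<bullet> (transpose_mat (proj D m e) *\<^sub>v ?t m i))"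
      using fin Pt v by (rule scalar_prod_vsum)
    also have "\<dots> = (\<Sum>m\<in>?ms. v_elem D v m e i \<bullet> ?t m i)"
      unfolding v_elem_def
      by (intro sum.cong refl scalar_prod_transpose_mult[OF proj_carrier[OF m] v t])
    finally show ?thesis .
  qed
  have stress: "\<sigma> e i j \<bullet> stress_rhs D v \<sigma> e i j
      = \<sigma> e i j \<bullet> ?G i j + (\<Sum>m\<in>?ms. (proj_n D m e j *\<^sub>v \<sigma> e i j) \<bullet> ?u m i)" for i j
  proof -
    have "\<sigma> e i j \<bullet> stress_rhs D v \<sigma> e i j
        = \<sigma> e i j \<bullet> ?G i j + \<sigma> e i j \<bullet> vsum ?N (\<lambda>m. transpose_mat (proj_n D m e j) *\<^sub>v ?u m i) ?ms"
      unfolding stress_rhs_def using G s Pu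
      by (intro scalar_prod_add_distrib[of _ ?N] vsum_closed) auto
    also have "\<sigma> e i j \<bullet> vsum ?N (\<lambda>m. transpose_mat (proj_n D m e j) *\<^sub>v ?u m i) ?ms
        = (\<Sum>m\<in>?ms. \<sigma> e i j \<bullet> (transpose_mat (proj_n D m e j) *\<^sub>v ?u m i))"
      using fin Pu s by (rule scalar_prod_vsum)
    also have "\<dots> = (\<Sum>m\<in>?ms. (proj_n D m e j *\<^sub>v \<sigma> e i j) \<bullet> ?u m i)"
      by (intro sum.cong refl scalar_prod_transpose_mult[OF proj_n_carrier[OF m] s u])
    finally show ?thesis .
  qed
  have T: "T_elem D \<sigma> m e i \<bullet> ?u m i = (\<Sum>j\<in>UNIV. (proj_n D m e j *\<^sub>v \<sigma> e i j) \<bullet> ?u m i)"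
    if "m \<in> ?ms" for m i
    unfolding T_elem_def using u[OF that]
    by (intro vsum_scalar_prod mult_mat_vec_carrier[OF proj_n_carrier[OF m[OF that]] s]) auto
  have "(\<Sum>i\<in>UNIV. \<Sum>j\<in>UNIV. \<Sum>m\<in>?ms. (proj_n D m e j *\<^sub>v \<sigma> e i j) \<bullet> ?u m i)
      = (\<Sum>i\<in>UNIV. \<Sum>m\<in>?ms. \<Sum>j\<in>UNIV. (proj_n D m e j *\<^sub>v \<sigma> e i j) \<bullet> ?u m i)"
    by (intro sum.cong refl sum.swap)
  also have "\<dots> = (\<Sum>i\<in>UNIV. \<Sum>m\<in>?ms. T_elem D \<sigma> m e i \<bullet> ?u m i)"
    by (intro sum.cong refl) (simp add: T)
  finally have tractions: "(\<Sum>i\<in>UNIV. \<Sum>j\<in>UNIV. \<Sum>m\<in>?ms. (proj_n D m e j *\<^sub>v \<sigma> e i j) \<bullet> ?u m i)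
      = (\<Sum>i\<in>UNIV. \<Sum>m\<in>?ms. T_elem D \<sigma> m e i \<bullet> ?u m i)" .
  have "(\<Sum>m\<in>?ms. side_power D v \<sigma> m e)
      = (\<Sum>i\<in>UNIV. \<Sum>m\<in>?ms. v_elem D v m e i \<bullet> ?t m i)
        + (\<Sum>i\<in>UNIV. \<Sum>m\<in>?ms. T_elem D \<sigma> m e i \<bullet> ?u m i)"
    unfolding side_power_def by (subst sum.swap) (simp add: sum.distrib)
  then show ?thesis
    unfolding velocity stress
    using volume_terms_cancel[OF state e] tractions
    by (simp add: sum.distrib sum_subtractf)
qed

text \<open>
  Exchanging the order of summation over incident pairs turns element powers into mortar energy
  rates.
\<close>

lemma total_power:
  assumes state: "dg_state D v \<sigma>"
  shows "(\<Sum>e\<in>elems D. (\<Sum>i\<in>UNIV. v e i \<bullet> velocity_rhs D v \<sigma> e i)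
      + (\<Sum>i\<in>UNIV. \<Sum>j\<in>UNIV. \<sigma> e i j \<bullet> stress_rhs D v \<sigma> e i j))
    = (\<Sum>m\<in>mortars D. int_energy_rate D v \<sigma> m)"
proof -
  have "(\<Sum>e\<in>elems D. (\<Sum>i\<in>UNIV. v e i \<bullet> velocity_rhs D v \<sigma> e i)
      + (\<Sum>i\<in>UNIV. \<Sum>j\<in>UNIV. \<sigma> e i j \<bullet> stress_rhs D v \<sigma> e i j))
      = (\<Sum>e\<in>elems D. \<Sum>m\<in>elem_mortars D e. side_power D v \<sigma> m e)"
    by (intro sum.cong refl element_power[OF state])
  also have "\<dots> = (\<Sum>e\<in>elems D. \<Sum>m\<in>{m \<in> mortars D. m \<in> elem_mortars D e}. side_power D v \<sigma> m e)"
    using elem_mortars by (intro sum.cong refl) auto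
  also have "\<dots> = (\<Sum>m\<in>mortars D. \<Sum>e\<in>{e \<in> elems D. m \<in> elem_mortars D e}. side_power D v \<sigma> m e)"
    using finite_elems finite_mortars by (rule sum.swap_restrict)
  also have "\<dots> = (\<Sum>m\<in>mortars D. int_energy_rate D v \<sigma> m)"
    using mortar_balance[OF state] by (intro sum.cong refl) (simp add: mortar_elems_def)
  finally show ?thesis .
qed

text \<open>
  The product rule yields two terms for each quadratic form. They agree by the symmetry of the mass
  matrices, for the compliance form after exchanging the index pairs by the major symmetry; this
  absorbs the factor \<open>1/2\<close>.
\<close>

lemma elem_energy_has_derivative:
  assumes state: "\<And>s. s \<ge> 0 \<Longrightarrow> dg_state D (v s) (\<sigma> s)" and e: "e \<in> elems D" and t: "t \<ge> 0"
    and dv: "\<And>i. has_vec_derivative (ndof D e) (\<lambda>s. v s e i) (v' i) (at t within {0..})"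
    and d\<sigma>: "\<And>i j. has_vec_derivative (ndof D e) (\<lambda>s. \<sigma> s e i j) (\<sigma>' i j) (at t within {0..})"
  shows "((\<lambda>s. elem_energy D (v s) (\<sigma> s) e) has_real_derivative
      (\<Sum>i\<in>UNIV. v t e i \<bullet> (mass_rho D e *\<^sub>v v' i))
      + (\<Sum>i\<in>UNIV. \<Sum>j\<in>UNIV. \<Sum>k\<in>UNIV. \<Sum>l\<in>UNIV. \<sigma> t e i j \<bullet> (mass_S D e i j k l *\<^sub>v \<sigma>' k l)))
    (at t within {0..})"
proof -
  let ?N = "ndof D e"
  have v: "v s e i \<in> carrier_vec ?N" and s: "\<sigma> s e i j \<in> carrier_vec ?N" if "s \<ge> 0" for s i j
    using state[OF that] e by (auto simp: dg_state_def)
  have v': "v' i \<in> carrier_vec ?N" and s': "\<sigma>' i j \<in> carrier_vec ?N" for i j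
    using dv[of i] d\<sigma>[of i j] by (auto simp: has_vec_derivative_def)
  have "((\<lambda>s. v s e i \<bullet> (mass_rho D e *\<^sub>v v s e i)) has_real_derivative
      v' i \<bullet> (mass_rho D e *\<^sub>v v t e i) + v t e i \<bullet> (mass_rho D e *\<^sub>v v' i)) (at t within {0..})" for i
    using v t by (intro bilinear_form_has_derivative[OF mass_rho_carrier[OF e] dv dv]) auto
  moreover have "v' i \<bullet> (mass_rho D e *\<^sub>v v t e i) = v t e i \<bullet> (mass_rho D e *\<^sub>v v' i)" for i
    by (rule symmetric_form_commute[OF mass_rho_carrier[OF e] mass_rho_sym[OF e] v' v[OF t]])
  ultimately have kinetic: "((\<lambda>s. \<Sum>i\<in>UNIV. v s e i \<bullet> (mass_rho D e *\<^sub>v v s e i)) has_real_derivative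
      (\<Sum>i\<in>UNIV. 2 * (v t e i \<bullet> (mass_rho D e *\<^sub>v v' i)))) (at t within {0..})"
    by (intro DERIV_sum) simp
  have "(\<Sum>i\<in>UNIV. \<Sum>j\<in>UNIV. \<Sum>k\<in>UNIV. \<Sum>l\<in>UNIV. \<sigma>' i j \<bullet> (mass_S D e i j k l *\<^sub>v \<sigma> t e k l))
      = (\<Sum>i\<in>UNIV. \<Sum>j\<in>UNIV. \<Sum>k\<in>UNIV. \<Sum>l\<in>UNIV. \<sigma> t e k l \<bullet> (mass_S D e k l i j *\<^sub>v \<sigma>' i j))"
  proof (intro sum.cong refl)
    fix i j k l
    have "\<sigma>' i j \<bullet> (mass_S D e i j k l *\<^sub>v \<sigma> t e k l) = \<sigma> t e k l \<bullet> (mass_S D e i j k l *\<^sub>v \<sigma>' i j)"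
      by (rule symmetric_form_commute[OF mass_S_carrier[OF e] mass_S_sym[OF e] s' s[OF t]])
    then show "\<sigma>' i j \<bullet> (mass_S D e i j k l *\<^sub>v \<sigma> t e k l)
        = \<sigma> t e k l \<bullet> (mass_S D e k l i j *\<^sub>v \<sigma>' i j)"
      by (simp only: mass_S_major[OF e, of i j k l])
  qed
  also have "\<dots> = (\<Sum>i\<in>UNIV. \<Sum>j\<in>UNIV. \<Sum>k\<in>UNIV. \<Sum>l\<in>UNIV. \<sigma> t e i j \<bullet> (mass_S D e i j k l *\<^sub>v \<sigma>' k l))"
    by (rule sum_swap_pairs)
  finally have swap: "(\<Sum>i\<in>UNIV. \<Sum>j\<in>UNIV. \<Sum>k\<in>UNIV. \<Sum>l\<in>UNIV. \<sigma>' i j \<bullet> (mass_S D e i j k l *\<^sub>v \<sigma> t e k l))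
      = (\<Sum>i\<in>UNIV. \<Sum>j\<in>UNIV. \<Sum>k\<in>UNIV. \<Sum>l\<in>UNIV. \<sigma> t e i j \<bullet> (mass_S D e i j k l *\<^sub>v \<sigma>' k l))" .
  have "((\<lambda>s. \<Sum>i\<in>UNIV. \<Sum>j\<in>UNIV. \<Sum>k\<in>UNIV. \<Sum>l\<in>UNIV. \<sigma> s e i j \<bullet> (mass_S D e i j k l *\<^sub>v \<sigma> s e k l))
      has_real_derivative (\<Sum>i\<in>UNIV. \<Sum>j\<in>UNIV. \<Sum>k\<in>UNIV. \<Sum>l\<in>UNIV.
        \<sigma>' i j \<bullet> (mass_S D e i j k l *\<^sub>v \<sigma> t e k l) + \<sigma> t e i j \<bullet> (mass_S D e i j k l *\<^sub>v \<sigma>' k l)))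
      (at t within {0..})"
    using s t by (intro DERIV_sum bilinear_form_has_derivative[OF mass_S_carrier[OF e] d\<sigma> d\<sigma>]) auto
  then have elastic: "((\<lambda>s. \<Sum>i\<in>UNIV. \<Sum>j\<in>UNIV. \<Sum>k\<in>UNIV. \<Sum>l\<in>UNIV.
        \<sigma> s e i j \<bullet> (mass_S D e i j k l *\<^sub>v \<sigma> s e k l))
      has_real_derivative 2 * (\<Sum>i\<in>UNIV. \<Sum>j\<in>UNIV. \<Sum>k\<in>UNIV. \<Sum>l\<in>UNIV.
        \<sigma> t e i j \<bullet> (mass_S D e i j k l *\<^sub>v \<sigma>' k l)))
      (at t within {0..})"
    by (simp only: sum.distrib swap) simp
  show ?thesis
    unfolding elem_energy_def
    using DERIV_add[OF DERIV_cmult[OF kinetic, of "1/2"] DERIV_cmult[OF elastic, of "1/2"]]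
    by (simp add: sum_distrib_left[symmetric])
qed

lemma energy_has_derivative:
  assumes sol: "dg_solution D v \<sigma>" and t: "t \<ge> 0"
  shows "((\<lambda>s. energy D (v s) (\<sigma> s)) has_real_derivative
    (\<Sum>m\<in>mortars D. int_energy_rate D (v t) (\<sigma> t) m)) (at t within {0..})"
proof -
  have state: "\<And>s. s \<ge> 0 \<Longrightarrow> dg_state D (v s) (\<sigma> s)"
    using sol by (simp add: dg_solution_def)
  obtain v' \<sigma>' where
    dv: "\<And>e i. e \<in> elems D \<Longrightarrow>
      has_vec_derivative (ndof D e) (\<lambda>s. v s e i) (v' t e i) (at t within {0..})" and
    d\<sigma>: "\<And>e i j. e \<in> elems D \<Longrightarrow>
      has_vec_derivative (ndof D e) (\<lambda>s. \<sigma> s e i j) (\<sigma>' t e i j) (at t within {0..})" and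
    velocity: "\<And>e i. e \<in> elems D \<Longrightarrow>
      mass_rho D e *\<^sub>v v' t e i = velocity_rhs D (v t) (\<sigma> t) e i" and
    stress: "\<And>e \<psi>. e \<in> elems D \<Longrightarrow>
      (\<forall>i j. \<psi> i j \<in> carrier_vec (ndof D e) \<and> \<psi> i j = \<psi> j i) \<Longrightarrow>
      (\<Sum>i\<in>UNIV. \<Sum>j\<in>UNIV. \<Sum>k\<in>UNIV. \<Sum>l\<in>UNIV. \<psi> i j \<bullet> (mass_S D e i j k l *\<^sub>v \<sigma>' t e k l))
        = (\<Sum>i\<in>UNIV. \<Sum>j\<in>UNIV. \<psi> i j \<bullet> stress_rhs D (v t) (\<sigma> t) e i j)"
    using sol t unfolding dg_solution_def by blast
  have "((\<lambda>s. elem_energy D (v s) (\<sigma> s) e) has_real_derivative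
      (\<Sum>i\<in>UNIV. v t e i \<bullet> velocity_rhs D (v t) (\<sigma> t) e i)
      + (\<Sum>i\<in>UNIV. \<Sum>j\<in>UNIV. \<sigma> t e i j \<bullet> stress_rhs D (v t) (\<sigma> t) e i j)) (at t within {0..})"
    if e: "e \<in> elems D" for e
  proof -
    have "\<forall>i j. \<sigma> t e i j \<in> carrier_vec (ndof D e) \<and> \<sigma> t e i j = \<sigma> t e j i"
      using state[OF t] e by (simp add: dg_state_def)
    from elem_energy_has_derivative[OF state e t dv[OF e] d\<sigma>[OF e]] show ?thesis
      unfolding velocity[OF e] stress[OF e \<open>\<forall>i j. _\<close>] .
  qed
  then show ?thesis
    unfolding energy_def total_power[OF state[OF t], symmetric] by (intro DERIV_sum)
qed

end

section \<open>Energy stability\<close>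

lemma nonincreasing_from_zero:
  fixes f :: "real \<Rightarrow> real"
  assumes deriv: "\<And>s. s \<ge> 0 \<Longrightarrow> (f has_real_derivative f' s) (at s within {0..})"
    and nonpos: "\<And>s. s \<ge> 0 \<Longrightarrow> f' s \<le> 0" and t: "t \<ge> 0"
  shows "f t \<le> f 0"
proof (rule DERIV_nonpos_imp_decreasing_open[OF t])
  fix s :: real assume "0 < s"
  moreover have "{0..} \<inter> {0<..} - {s} = UNIV \<inter> {0<..} - {s}"
    by auto
  ultimately have "at s within {0..} = at s"
    by (intro at_within_nhd[of s "{0<..}"]) auto
  then show "\<exists>y. (f has_real_derivative y) (at s) \<and> y \<le> 0"
    using deriv[of s] nonpos[of s] \<open>0 < s\<close> by auto
next
  have "continuous_on {0..} f"
    by (rule DERIV_continuous_on[of _ _ f']) (use deriv in auto)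
  then show "continuous_on {0..t} f"
    by (rule continuous_on_subset) auto
qed

theorem theorem3:
  fixes D :: "('e, 'm, 'p) dg_data"
  assumes dg: "dg_method D"
    and interior: "\<And>m \<xi> vm vp Tm Tp Ts vs.
      \<lbrakk>m \<in> int_mortars D; \<xi> \<in> ref_mortar D m; flux_int D m \<xi> vm vp Tm Tp = (Ts, vs)\<rbrakk> \<Longrightarrow>
      surf_jac D m \<xi> * (\<Sum>i\<in>UNIV. (vm i - vp i) * Ts i + vs i * (Tm i - Tp i)
                                  - vm i * Tm i + vp i * Tp i) \<le> 0"
    and boundary: "\<And>m \<xi> vm Tm Ts vs.
      \<lbrakk>m \<in> bdry_mortars D; \<xi> \<in> ref_mortar D m; flux_bdry D m \<xi> vm Tm = (Ts, vs)\<rbrakk> \<Longrightarrow>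
      surf_jac D m \<xi> * (\<Sum>i\<in>UNIV. vm i * Ts i + vs i * Tm i - vm i * Tm i) \<le> 0"
  shows "(\<forall>v \<sigma>. dg_state D v \<sigma> \<longrightarrow>
            (\<forall>m\<in>int_mortars D. int_energy_rate D v \<sigma> m \<le> 0) \<and>
            (\<forall>m\<in>bdry_mortars D. bdry_energy_rate D v \<sigma> m \<le> 0)) \<and>
         (\<forall>v \<sigma>. dg_solution D v \<sigma> \<longrightarrow>
            (\<forall>t\<ge>0. energy D (v t) (\<sigma> t) \<le> energy D (v 0) (\<sigma> 0)))"
proof -
  interpret dg_method D by (rule dg)
  have node_terms: "quad_weight D m n * r \<le> 0"
    if "m \<in> mortars D" "n < nquad D m" "r \<le> 0" for m n r
    using quad_weight_pos[OF that(1,2)] that(3) by (simp add: mult_nonneg_nonpos)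
  have int_rate: "int_energy_rate D v \<sigma> m \<le> 0"
    if state: "dg_state D v \<sigma>" and m: "m \<in> int_mortars D" for v \<sigma> m
  proof -
    have mm: "m \<in> mortars D" and nb: "m \<notin> bdry_mortars D"
      using m by (auto simp: int_mortars_def)
    show ?thesis
      unfolding int_energy_rate_nodes[OF state mm]
    proof (intro sum_nonpos node_terms[OF mm])
      fix n assume "n \<in> {..<nquad D m}"
      then have n: "n < nquad D m" by simp
      show "n < nquad D m" by (fact n)
      show "surf_jac D m (quad_node D m n) * (\<Sum>i\<in>UNIV.
          (v_minus D v m i $ n - v_plus D v m i $ n) * T_star D v \<sigma> m i $ n
        + v_star D v \<sigma> m i $ n * (T_minus D \<sigma> m i $ n - T_plus D \<sigma> m i $ n)
        - v_minus D v m i $ n * T_minus D \<sigma> m i $ n + v_plus D v m i $ n * T_plus D \<sigma> m i $ n) \<le> 0"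
        by (rule interior[OF m quad_node[OF mm n]])
           (use n nb in \<open>simp add: T_star_def v_star_def flux_at_node_def\<close>)
    qed
  qed
  have bdry_rate: "bdry_energy_rate D v \<sigma> m \<le> 0"
    if state: "dg_state D v \<sigma>" and m: "m \<in> bdry_mortars D" for v \<sigma> m
  proof -
    have mm: "m \<in> mortars D"
      using m bdry_mortars by auto
    show ?thesis
      unfolding bdry_energy_rate_nodes[OF state mm]
    proof (intro sum_nonpos node_terms[OF mm])
      fix n assume "n \<in> {..<nquad D m}"
      then have n: "n < nquad D m" by simp
      show "n < nquad D m" by (fact n)
      show "surf_jac D m (quad_node D m n) * (\<Sum>i\<in>UNIV.
          v_minus D v m i $ n * T_star D v \<sigma> m i $ n
        + v_star D v \<sigma> m i $ n * T_minus D \<sigma> m i $ n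
        - v_minus D v m i $ n * T_minus D \<sigma> m i $ n) \<le> 0"
        by (rule boundary[OF m quad_node[OF mm n]])
           (use n m in \<open>simp add: T_star_def v_star_def flux_at_node_def\<close>)
    qed
  qed
  have rate: "int_energy_rate D v \<sigma> m \<le> 0"
    if state: "dg_state D v \<sigma>" and m: "m \<in> mortars D" for v \<sigma> m
    using int_rate[OF state] bdry_rate[OF state] bdry_rate_eq_int_rate[OF state] m
    by (cases "m \<in> bdry_mortars D") (auto simp: int_mortars_def)
  have "energy D (v t) (\<sigma> t) \<le> energy D (v 0) (\<sigma> 0)"
    if sol: "dg_solution D v \<sigma>" and t: "t \<ge> 0" for v \<sigma> t
  proof (rule nonincreasing_from_zero[OF _ _ t])
    fix s :: real assume s: "s \<ge> 0"
    show "((\<lambda>s. energy D (v s) (\<sigma> s)) has_real_derivative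
        (\<Sum>m\<in>mortars D. int_energy_rate D (v s) (\<sigma> s) m)) (at s within {0..})"
      using sol s by (rule energy_has_derivative)
    have "dg_state D (v s) (\<sigma> s)"
      using sol s by (simp add: dg_solution_def)
    then show "(\<Sum>m\<in>mortars D. int_energy_rate D (v s) (\<sigma> s) m) \<le> 0"
      by (intro sum_nonpos rate)
  qed
  with int_rate bdry_rate show ?thesis by blast
qed

end
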